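(* Let $K$ and $L$ be finite abstract simplicial complexes having the same strong homotopy type. Then $\mathrm{TC}(K)=\mathrm{TC}(L)$, where $\mathrm{TC}$ denotes the discrete topological complexity. That is, the discrete topological complexity is an invariant of the strong homotopy type.
   Context: Contiguity: two simplicial maps $\varphi,\psi\colon K\to L$ are contiguous ($\varphi\sim_c\psi$) if for every simplex $\sigma\in K$ the union of vertex sets $\varphi(\sigma)\cup\psi(\sigma)$ is a simplex of $L$. They are in the same contiguity class ($\varphi\sim\psi$) if there is a finite sequence of simplicial maps $\varphi=h_0\sim_c h_1\sim_c\cdots\sim_c h_m=\psi$ from $K$ to $L$. Strong homotopy type: two finite complexes $K,L$ have the same strong homotopy type ($K\sim L$) if they are connected by a sequence of elementary strong collapses and expansions; equivalently, if there exist simplicial maps $\varphi\colon K\to L$ and $\psi\colon L\to K$ with $\varphi\circ\psi\sim 1_L$ and $\psi\circ\varphi\sim 1_K$. Categorical product: $K^2=K\,\Pi\,K$ is the simplicial complex with vertex set $V(K)\times V(K)$, in which a finite set $\sigma$ of vertices is a simplex if and only if both projections $\pi_1(\sigma)$ and $\pi_2(\sigma)$ are simplices of $K$. The diagonal $\Delta\colon K\to K^2$ is the simplicial map $\Delta(v)=(v,v)$. A subcomplex $\Omega\subset K^2$, with inclusion $\iota_\Omega\colon\Omega\to K^2$, is a Farber subcomplex if there exists a simplicial map $\sigma\colon\Omega\to K$ such that $\Delta\circ\sigma\sim\iota_\Omega$. The discrete topological complexity $\mathrm{TC}(K)$ is the least integer $n\ge 0$ such that $K^2=\Omega_0\cup\cdots\cup\Omega_n$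 for some Farber subcomplexes $\Omega_0,\dots,\Omega_n$ of $K^2$ (with $\mathrm{TC}(K)=\infty$ if there is no such $n$). *)

theory Defs
  imports Main "HOL-Library.Extended_Nat"
begin

(* Simplices are nonempty; the vertices are exactly the points of the simplices. *)
definition simplicial_complex :: "'a set set \<Rightarrow> bool" where
  "simplicial_complex K \<longleftrightarrow>
     (\<forall>s\<in>K. finite s \<and> s \<noteq> {}) \<and> (\<forall>s\<in>K. \<forall>t. t \<subseteq> s \<and> t \<noteq> {} \<longrightarrow> t \<in> K)"

definition finite_simplicial_complex :: "'a set set \<Rightarrow> bool" where
  "finite_simplicial_complex K \<longleftrightarrow> simplicial_complex K \<and> finite K"

definition vertices :: "'a set set \<Rightarrow> 'a set" where
  "vertices K = \<Union>K"

definition subcomplex :: "'a set set \<Rightarrow> 'a set set \<Rightarrow> bool" where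
  "subcomplex U K \<longleftrightarrow> simplicial_complex U \<and> U \<subseteq> K"

(* A map of complexes is a total HOL function of which only the values on the vertices of
   the source matter; functions agreeing there are contiguous. *)
definition simplicial_map :: "'a set set \<Rightarrow> 'b set set \<Rightarrow> ('a \<Rightarrow> 'b) \<Rightarrow> bool" where
  "simplicial_map K L f \<longleftrightarrow> (\<forall>s\<in>K. f ` s \<in> L)"

definition contiguous :: "'a set set \<Rightarrow> 'b set set \<Rightarrow> ('a \<Rightarrow> 'b) \<Rightarrow> ('a \<Rightarrow> 'b) \<Rightarrow> bool" where
  "contiguous K L f g \<longleftrightarrow>
     simplicial_map K L f \<and> simplicial_map K L g \<and> (\<forall>s\<in>K. f ` s \<union> g ` s \<in> L)"

definition same_contiguity_class ::
    "'a set set \<Rightarrow> 'b set set \<Rightarrow> ('a \<Rightarrow> 'b) \<Rightarrow> ('a \<Rightarrow> 'b) \<Rightarrow> bool" where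
  "same_contiguity_class K L f g \<longleftrightarrow>
     simplicial_map K L f \<and> simplicial_map K L g \<and> (contiguous K L)\<^sup>*\<^sup>* f g"

definition maximal_simplex :: "'a set set \<Rightarrow> 'a set \<Rightarrow> bool" where
  "maximal_simplex K s \<longleftrightarrow> s \<in> K \<and> (\<forall>t\<in>K. s \<subseteq> t \<longrightarrow> t = s)"

definition dominated_by :: "'a set set \<Rightarrow> 'a \<Rightarrow> 'a \<Rightarrow> bool" where
  "dominated_by K v w \<longleftrightarrow>
     v \<in> vertices K \<and> w \<in> vertices K \<and> w \<noteq> v \<and>
     (\<forall>s. maximal_simplex K s \<and> v \<in> s \<longrightarrow> w \<in> s)"

definition delete_vertex :: "'a set set \<Rightarrow> 'a \<Rightarrow> 'a set set" where
  "delete_vertex K v = {s \<in> K. v \<notin> s}"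

definition elementary_strong_collapse :: "'a set set \<Rightarrow> 'a set set \<Rightarrow> bool" where
  "elementary_strong_collapse K L \<longleftrightarrow>
     finite_simplicial_complex K \<and> (\<exists>v w. dominated_by K v w \<and> L = delete_vertex K v)"

definition elementary_strong_move :: "'a set set \<Rightarrow> 'a set set \<Rightarrow> bool" where
  "elementary_strong_move K L \<longleftrightarrow>
     elementary_strong_collapse K L \<or> elementary_strong_collapse L K"

(* A sequence of collapses and expansions needs a common supply of vertices that always
   contains fresh ones, whereas 'a and 'b may be different or finite types. So finite complexes
   are first relabelled by natural numbers. The choice of labels is immaterial: renaming a
   vertex v to a fresh v' is the expansion adding v' dominated by v (with the simplices of
   the star of v, where v may be replaced by v' or joined by it), followed by the collapse
   deleting v, now dominated by v'. *)
definition same_strong_homotopy_type :: "'a set set \<Rightarrow> 'b set set \<Rightarrow> bool" where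
  "same_strong_homotopy_type K L \<longleftrightarrow>
     (\<exists>(f :: 'a \<Rightarrow> nat) (g :: 'b \<Rightarrow> nat).
        inj_on f (vertices K) \<and> inj_on g (vertices L) \<and>
        elementary_strong_move\<^sup>*\<^sup>* ((`) f ` K) ((`) g ` L))"

definition categorical_product :: "'a set set \<Rightarrow> 'b set set \<Rightarrow> ('a \<times> 'b) set set" where
  "categorical_product K L =
     {s. finite s \<and> s \<subseteq> vertices K \<times> vertices L \<and> fst ` s \<in> K \<and> snd ` s \<in> L}"

definition diagonal :: "'a \<Rightarrow> 'a \<times> 'a" where
  "diagonal v = (v, v)"

definition farber_subcomplex :: "'a set set \<Rightarrow> ('a \<times> 'a) set set \<Rightarrow> bool" where
  "farber_subcomplex K U \<longleftrightarrow>
     subcomplex U (categorical_product K K) \<and>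
     (\<exists>\<sigma>. simplicial_map U K \<sigma> \<and>
        same_contiguity_class U (categorical_product K K) (diagonal \<circ> \<sigma>) id)"

(* The infimum of the empty set is \<infinity>. *)
definition discrete_TC :: "'a set set \<Rightarrow> enat" where
  "discrete_TC K =
     Inf {enat n | n. \<exists>U :: nat \<Rightarrow> ('a \<times> 'a) set set.
            (\<forall>i\<le>n. farber_subcomplex K (U i)) \<and> categorical_product K K = (\<Union>i\<le>n. U i)}"

end

theory Submission
  imports Defs
begin

text \<open>
  The invariance has two independent ingredients.

  First, \<^term>\<open>discrete_TC\<close> is monotone under domination: if \<open>\<phi> : K \<rightarrow> L\<close> and \<open>\<psi> : L \<rightarrow> K\<close> are
  simplicial with \<open>\<phi> \<circ> \<psi>\<close> in the contiguity class of the identity of \<open>L\<close>, then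
  \<open>TC L \<le> TC K\<close>. A Farber subcomplex \<open>U\<close> of the square of \<open>K\<close> with section \<open>\<sigma>\<close> is pulled back
  along \<open>\<psi> \<times> \<psi>\<close>, and the pullback has the section \<open>\<phi> \<circ> \<sigma> \<circ> (\<psi> \<times> \<psi>)\<close>, because on it
  \<open>\<Delta> \<circ> \<phi> \<circ> \<sigma> \<circ> (\<psi> \<times> \<psi>) = (\<phi> \<times> \<phi>) \<circ> \<Delta> \<circ> \<sigma> \<circ> (\<psi> \<times> \<psi>) \<sim> (\<phi> \<times> \<phi>) \<circ> (\<psi> \<times> \<psi>) = (\<phi> \<circ> \<psi>) \<times> (\<phi> \<circ> \<psi>) \<sim> 1\<close>.
  Pulling back preserves covers, so a cover of the square of \<open>K\<close> yields one of the square of \<open>L\<close>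
  with the same number of pieces (lemma \<open>discrete_TC_le_if_dominated\<close>).

  Secondly, complexes of the same strong homotopy type dominate each other. If \<open>v\<close> is
  dominated by \<open>w\<close>, the inclusion of the complex without \<open>v\<close> has as its inverse, up to contiguity,
  the retraction that sends \<open>v\<close> to \<open>w\<close>: every simplex containing \<open>v\<close> lies in a maximal one,
  which also contains \<open>w\<close>, so a simplex and its image span a simplex and the retraction is contiguous to
  the identity (lemma \<open>strong_equivalence_of_collapse\<close>). Equivalences up to contiguity class
  compose, so chains of such moves, with a relabelling of the vertices at both ends, give an
  equivalence as well.
\<close>

section \<open>Contiguity classes\<close>

lemma simplicial_map_comp:
  "simplicial_map K L f \<Longrightarrow> simplicial_map L M g \<Longrightarrow> simplicial_map K M (g \<circ> f)"
  unfolding simplicial_map_def image_comp [symmetric] by blast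

lemma contiguous_comp_left:
  assumes "simplicial_map L M h" "contiguous K L f g"
  shows "contiguous K M (h \<circ> f) (h \<circ> g)"
  using assms unfolding contiguous_def simplicial_map_def image_comp [symmetric]
  by (simp add: image_Un [symmetric])

lemma contiguous_comp_right:
  assumes "simplicial_map J K h" "contiguous K L f g"
  shows "contiguous J L (f \<circ> h) (g \<circ> h)"
  using assms unfolding contiguous_def simplicial_map_def image_comp [symmetric] by blast

lemma same_contiguity_class_if_contiguous:
  "contiguous K L f g \<Longrightarrow> same_contiguity_class K L f g"
  by (auto simp: same_contiguity_class_def contiguous_def)

lemma same_contiguity_class_trans:
  assumes "same_contiguity_class K L f g" "same_contiguity_class K L g h"
  shows "same_contiguity_class K L f h"
  using assms by (auto simp: same_contiguity_class_def)

text \<open>An operation on maps that respects contiguity respects contiguity classes, since it carries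
  a chain of contiguities to such a chain. Compositions and squaring are all instances.\<close>

lemma same_contiguity_class_transport:
  assumes "same_contiguity_class K L f g"
    and T: "\<And>p q. contiguous K L p q \<Longrightarrow> contiguous K' L' (T p) (T q)"
  shows "same_contiguity_class K' L' (T f) (T g)"
proof -
  have "(contiguous K L)\<^sup>*\<^sup>* f g" and "contiguous K L f f" and "contiguous K L g g"
    using assms(1) by (auto simp: same_contiguity_class_def contiguous_def simplicial_map_def)
  from this(1) have "(contiguous K' L')\<^sup>*\<^sup>* (T f) (T g)"
    by (induction rule: rtranclp_induct) (auto intro: rtranclp.rtrancl_into_rtrancl T)
  then show ?thesis
    using T[OF \<open>contiguous K L f f\<close>] T[OF \<open>contiguous K L g g\<close>]
    by (simp add: same_contiguity_class_def contiguous_def)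
qed

lemma same_contiguity_class_comp_left:
  assumes "simplicial_map L M h" "same_contiguity_class K L f g"
  shows "same_contiguity_class K M (h \<circ> f) (h \<circ> g)"
  using same_contiguity_class_transport[OF assms(2)] contiguous_comp_left[OF assms(1)] by blast

lemma same_contiguity_class_comp_right:
  assumes "simplicial_map J K h" "same_contiguity_class K L f g"
  shows "same_contiguity_class J L (f \<circ> h) (g \<circ> h)"
  using same_contiguity_class_transport[OF assms(2), where T = "\<lambda>p. p \<circ> h"]
    contiguous_comp_right[OF assms(1)] by blast

section \<open>Squares of maps\<close>

lemma mem_categorical_product_iff:
  "s \<in> categorical_product K L \<longleftrightarrow> finite s \<and> fst ` s \<in> K \<and> snd ` s \<in> L"
  unfolding categorical_product_def vertices_def by force

lemma face_in_complex:
  assumes "simplicial_complex K" "s \<in> K" "t \<subseteq> s" "t \<noteq> {}"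
  shows "t \<in> K"
  using assms unfolding simplicial_complex_def by blast

lemma simplicial_complex_categorical_product:
  assumes "simplicial_complex K" "simplicial_complex L"
  shows "simplicial_complex (categorical_product K L)"
  unfolding simplicial_complex_def
proof (intro conjI ballI allI impI)
  fix s assume s: "s \<in> categorical_product K L"
  then show "finite s" and "s \<noteq> {}"
    using assms by (auto simp: mem_categorical_product_iff simplicial_complex_def)
  fix t assume "t \<subseteq> s \<and> t \<noteq> {}"
  then have "finite t" "fst ` t \<subseteq> fst ` s" "fst ` t \<noteq> {}" "snd ` t \<subseteq> snd ` s" "snd ` t \<noteq> {}"
    using \<open>finite s\<close> by (auto intro: finite_subset)
  then show "t \<in> categorical_product K L"
    using s face_in_complex[OF assms(1), of "fst ` s" "fst ` t"]
      face_in_complex[OF assms(2), of "snd ` s" "snd ` t"]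
    by (simp add: mem_categorical_product_iff)
qed

lemma image_map_prod_projections:
  "fst ` map_prod f g ` s = f ` fst ` s" "snd ` map_prod f g ` s = g ` snd ` s"
  by (simp_all add: image_image)

lemma simplicial_map_map_prod:
  assumes "simplicial_map K L f"
  shows "simplicial_map (categorical_product K K) (categorical_product L L) (map_prod f f)"
  using assms
  by (simp add: simplicial_map_def mem_categorical_product_iff image_map_prod_projections)

lemma contiguous_map_prod:
  assumes "contiguous K L f g"
  shows "contiguous (categorical_product K K) (categorical_product L L)
           (map_prod f f) (map_prod g g)"
  using assms
  by (simp add: contiguous_def simplicial_map_map_prod mem_categorical_product_iff image_Un
      image_map_prod_projections)

lemma same_contiguity_class_map_prod:
  assumes "same_contiguity_class K L f g"
  shows "same_contiguity_class (categorical_product K K) (categorical_product L L)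
           (map_prod f f) (map_prod g g)"
  by (rule same_contiguity_class_transport[OF assms, where T = "\<lambda>p. map_prod p p"])
    (rule contiguous_map_prod)

section \<open>Monotonicity of topological complexity under domination\<close>

definition pullback_complex :: "('a \<Rightarrow> 'b) \<Rightarrow> 'a set set \<Rightarrow> 'b set set \<Rightarrow> 'a set set" where
  "pullback_complex f K U = {s \<in> K. f ` s \<in> U}"

lemma simplicial_complex_pullback_complex:
  assumes "simplicial_complex K" "simplicial_complex U"
  shows "simplicial_complex (pullback_complex f K U)"
  unfolding simplicial_complex_def
proof (intro conjI ballI allI impI)
  fix s assume s: "s \<in> pullback_complex f K U"
  then show "finite s" and "s \<noteq> {}"
    using assms(1) by (auto simp: pullback_complex_def simplicial_complex_def)
  fix t assume t: "t \<subseteq> s \<and> t \<noteq> {}"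
  have "t \<in> K" and "f ` t \<in> U"
    using s t face_in_complex[OF assms(1), of s t]
      face_in_complex[OF assms(2), of "f ` s" "f ` t"]
    by (simp_all add: pullback_complex_def image_mono)
  then show "t \<in> pullback_complex f K U"
    by (simp add: pullback_complex_def)
qed

lemma farber_subcomplex_pullback:
  assumes L: "simplicial_complex L"
    and phi: "simplicial_map K L \<phi>" and psi: "simplicial_map L K \<psi>"
    and ret: "same_contiguity_class L L (\<phi> \<circ> \<psi>) id"
    and U: "farber_subcomplex K U"
  shows "farber_subcomplex L (pullback_complex (map_prod \<psi> \<psi>) (categorical_product L L) U)"
    (is "farber_subcomplex L ?V")
proof -
  let ?K2 = "categorical_product K K" and ?L2 = "categorical_product L L"
  from U obtain \<sigma> where sub: "simplicial_complex U" "U \<subseteq> ?K2"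
    and sig: "simplicial_map U K \<sigma>"
    and far: "same_contiguity_class U ?K2 (diagonal \<circ> \<sigma>) id"
    by (auto simp: farber_subcomplex_def subcomplex_def)
  let ?\<tau> = "\<phi> \<circ> \<sigma> \<circ> map_prod \<psi> \<psi>"
  have V: "subcomplex ?V ?L2"
    using simplicial_complex_pullback_complex[OF simplicial_complex_categorical_product[OF L L] sub(1)]
    by (auto simp: subcomplex_def pullback_complex_def)
  have VU: "simplicial_map ?V U (map_prod \<psi> \<psi>)" and VL: "simplicial_map ?V ?L2 id"
    by (auto simp: simplicial_map_def pullback_complex_def)
  have tau: "simplicial_map ?V L ?\<tau>"
    using simplicial_map_comp[OF VU simplicial_map_comp[OF sig phi]] by (simp add: comp_assoc)
  have "same_contiguity_class ?V ?L2 (map_prod \<phi> \<phi> \<circ> (diagonal \<circ> \<sigma> \<circ> map_prod \<psi> \<psi>))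
          (map_prod \<phi> \<phi> \<circ> (id \<circ> map_prod \<psi> \<psi>))"
    using same_contiguity_class_comp_left[OF simplicial_map_map_prod[OF phi]
        same_contiguity_class_comp_right[OF VU far]] .
  \<comment> \<open>The diagonal is natural, so \<open>\<phi> \<times> \<phi>\<close> can be moved past it.\<close>
  moreover have "map_prod \<phi> \<phi> \<circ> (diagonal \<circ> \<sigma> \<circ> map_prod \<psi> \<psi>) = diagonal \<circ> ?\<tau>"
    by (auto simp: diagonal_def fun_eq_iff)
  moreover have "map_prod \<phi> \<phi> \<circ> (id \<circ> map_prod \<psi> \<psi>) = map_prod (\<phi> \<circ> \<psi>) (\<phi> \<circ> \<psi>)"
    by (auto simp: fun_eq_iff)
  moreover have "same_contiguity_class ?V ?L2 (map_prod (\<phi> \<circ> \<psi>) (\<phi> \<circ> \<psi>)) id"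
    using same_contiguity_class_comp_right[OF VL same_contiguity_class_map_prod[OF ret]]
    by (simp add: prod.map_id0)
  ultimately have "same_contiguity_class ?V ?L2 (diagonal \<circ> ?\<tau>) id"
    by (simp only: same_contiguity_class_trans[of _ _ "diagonal \<circ> ?\<tau>" "map_prod (\<phi> \<circ> \<psi>) (\<phi> \<circ> \<psi>)" id])
  with V tau show ?thesis
    by (auto simp: farber_subcomplex_def)
qed

lemma discrete_TC_le_if_dominated:
  fixes K :: "'a set set" and L :: "'b set set"
  assumes L: "simplicial_complex L"
    and phi: "simplicial_map K L \<phi>" and psi: "simplicial_map L K \<psi>"
    and ret: "same_contiguity_class L L (\<phi> \<circ> \<psi>) id"
  shows "discrete_TC L \<le> discrete_TC K"
  unfolding discrete_TC_def
proof (rule Inf_superset_mono, clarify)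
  fix n and U :: "nat \<Rightarrow> ('a \<times> 'a) set set"
  assume far: "\<forall>i\<le>n. farber_subcomplex K (U i)"
    and cover: "categorical_product K K = (\<Union>i\<le>n. U i)"
  let ?V = "\<lambda>i. pullback_complex (map_prod \<psi> \<psi>) (categorical_product L L) (U i)"
  have "\<forall>i\<le>n. farber_subcomplex L (?V i)"
    using far farber_subcomplex_pullback[OF L phi psi ret] by blast
  moreover have "categorical_product L L = (\<Union>i\<le>n. ?V i)"
  proof -
    have "map_prod \<psi> \<psi> ` s \<in> (\<Union>i\<le>n. U i)" if "s \<in> categorical_product L L" for s
      using simplicial_map_map_prod[OF psi] that unfolding cover [symmetric] simplicial_map_def
      by blast
    then show ?thesis
      unfolding pullback_complex_def by blast
  qed
  ultimately show "\<exists>m. enat n = enat m \<and> (\<exists>V. (\<forall>i\<le>m. farber_subcomplex L (V i)) \<and>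
      categorical_product L L = (\<Union>i\<le>m. V i))"
    by (intro exI[of _ n] exI[of _ ?V] conjI refl)
qed

section \<open>Equivalences up to contiguity class\<close>

definition strong_equivalence ::
    "'a set set \<Rightarrow> 'b set set \<Rightarrow> ('a \<Rightarrow> 'b) \<Rightarrow> ('b \<Rightarrow> 'a) \<Rightarrow> bool" where
  "strong_equivalence K L \<phi> \<psi> \<longleftrightarrow>
     simplicial_map K L \<phi> \<and> simplicial_map L K \<psi> \<and>
     same_contiguity_class K K (\<psi> \<circ> \<phi>) id \<and> same_contiguity_class L L (\<phi> \<circ> \<psi>) id"

lemma strong_equivalence_sym: "strong_equivalence K L \<phi> \<psi> \<Longrightarrow> strong_equivalence L K \<psi> \<phi>"
  by (simp add: strong_equivalence_def)

text \<open>A composite round trip contains the round trip of the middle complex, which can be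
  contracted inside the outer one; what remains is the round trip of the outer pair.\<close>

lemma same_contiguity_class_round_trip:
  assumes "simplicial_map K L \<phi>" "simplicial_map L K \<psi>"
    and "same_contiguity_class K K (\<psi> \<circ> \<phi>) id" "same_contiguity_class L L r id"
  shows "same_contiguity_class K K (\<psi> \<circ> r \<circ> \<phi>) id"
proof -
  have "same_contiguity_class K K (\<psi> \<circ> (r \<circ> \<phi>)) (\<psi> \<circ> (id \<circ> \<phi>))"
    by (intro same_contiguity_class_comp_left[OF assms(2)]
        same_contiguity_class_comp_right[OF assms(1)] assms(4))
  then show ?thesis
    using same_contiguity_class_trans[OF _ assms(3)] by (simp add: comp_assoc)
qed

lemma strong_equivalence_trans:
  assumes "strong_equivalence K L \<phi> \<psi>" "strong_equivalence L M \<phi>' \<psi>'"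
  shows "strong_equivalence K M (\<phi>' \<circ> \<phi>) (\<psi> \<circ> \<psi>')"
proof -
  note KL = assms(1)[unfolded strong_equivalence_def]
    and LM = assms(2)[unfolded strong_equivalence_def]
  have "simplicial_map K M (\<phi>' \<circ> \<phi>)" "simplicial_map M K (\<psi> \<circ> \<psi>')"
    using KL LM simplicial_map_comp by blast+
  moreover have "same_contiguity_class K K (\<psi> \<circ> (\<psi>' \<circ> \<phi>') \<circ> \<phi>) id"
    using KL LM same_contiguity_class_round_trip by blast
  moreover have "same_contiguity_class M M (\<phi>' \<circ> (\<phi> \<circ> \<psi>) \<circ> \<psi>') id"
    using KL LM same_contiguity_class_round_trip by blast
  ultimately show ?thesis
    by (simp only: strong_equivalence_def comp_assoc simp_thms)
qed

text \<open>Such a map sends every simplex to itself. It need not equal \<^term>\<open>id\<close> as a function: a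
  relabelling followed by its partial inverse is controlled only on the vertices.\<close>

lemma same_contiguity_class_id_if_fixes_vertices:
  assumes "\<And>v. v \<in> vertices K \<Longrightarrow> h v = v"
  shows "same_contiguity_class K K h id"
proof -
  have "h ` s = s" if "s \<in> K" for s
    using that assms by (force simp: vertices_def)
  then show ?thesis
    by (intro same_contiguity_class_if_contiguous) (simp add: contiguous_def simplicial_map_def)
qed

lemma strong_equivalence_relabelling:
  assumes "inj_on f (vertices K)"
  shows "strong_equivalence K ((`) f ` K) f (inv_into (vertices K) f)"
proof -
  let ?g = "inv_into (vertices K) f"
  have gf: "?g (f v) = v" if "v \<in> vertices K" for v
    using assms that by simp
  have "?g ` f ` s = s" if "s \<in> K" for s
    using that gf by (force simp: vertices_def)
  then have "simplicial_map ((`) f ` K) K ?g"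
    by (auto simp: simplicial_map_def)
  moreover have "f (?g w) = w" if "w \<in> vertices ((`) f ` K)" for w
    using that by (auto simp: vertices_def intro!: f_inv_into_f)
  ultimately show ?thesis
    using gf by (auto simp: strong_equivalence_def simplicial_map_def
        intro!: same_contiguity_class_id_if_fixes_vertices)
qed

section \<open>Strong collapses are equivalences\<close>

lemma simplex_in_maximal_simplex:
  assumes "finite K" "s \<in> K"
  obtains m where "maximal_simplex K m" "s \<subseteq> m"
  using finite_has_maximal2[OF assms] unfolding maximal_simplex_def by metis

text \<open>Domination speaks of maximal simplices only; it reaches the others because in a finite
  complex each simplex is a face of a maximal one.\<close>

lemma insert_dominating_vertex:
  assumes K: "finite_simplicial_complex K" and dom: "dominated_by K v w"
    and s: "s \<in> K" "v \<in> s"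
  shows "insert w s \<in> K"
proof -
  obtain m where m: "maximal_simplex K m" "s \<subseteq> m"
    using simplex_in_maximal_simplex K s(1) by (metis finite_simplicial_complex_def)
  then have "insert w s \<subseteq> m" "m \<in> K"
    using dom s(2) by (auto simp: dominated_by_def maximal_simplex_def)
  then show ?thesis
    using K face_in_complex[of K m "insert w s"] by (simp add: finite_simplicial_complex_def)
qed

lemma strong_equivalence_of_collapse:
  assumes K: "finite_simplicial_complex K" and dom: "dominated_by K v w"
  shows "strong_equivalence K (delete_vertex K v) (id(v := w)) id"
proof -
  let ?r = "id(v := w)" and ?L = "delete_vertex K v"
  have wv: "w \<noteq> v"
    using dom by (simp add: dominated_by_def)
  have subset: "t \<in> K" if "s \<in> K" "t \<subseteq> s" "t \<noteq> {}" for s t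
    using K face_in_complex[OF _ that] by (simp add: finite_simplicial_complex_def)
  have *: "s \<union> ?r ` s \<in> K" if s: "s \<in> K" for s
  proof (cases "v \<in> s")
    case True
    then have "s \<union> ?r ` s = insert w s"
      by auto
    then show ?thesis
      using insert_dominating_vertex[OF K dom s True] by simp
  next
    case False
    then have "?r ` s = s"
      by (force simp: image_iff)
    then show ?thesis
      using s by simp
  qed
  have rK: "?r ` s \<in> K" if "s \<in> K" for s
  proof -
    have "s \<noteq> {}"
      using K that by (auto simp: finite_simplicial_complex_def simplicial_complex_def)
    then show ?thesis
      by (intro subset[OF *[OF that]]) blast+
  qed
  have "v \<notin> ?r ` s" for s
    using wv by auto
  then have r: "simplicial_map K ?L ?r"
    using rK by (simp add: simplicial_map_def delete_vertex_def)
  have "contiguous K K ?r id"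
    using rK * by (simp add: contiguous_def simplicial_map_def Un_commute)
  then have "same_contiguity_class K K (id \<circ> ?r) id"
    by (simp add: same_contiguity_class_if_contiguous)
  moreover have "same_contiguity_class ?L ?L (?r \<circ> id) id"
    by (rule same_contiguity_class_id_if_fixes_vertices) (auto simp: vertices_def delete_vertex_def)
  ultimately show ?thesis
    using r by (auto simp: strong_equivalence_def simplicial_map_def delete_vertex_def)
qed

lemma strong_equivalence_of_moves:
  assumes "elementary_strong_move\<^sup>*\<^sup>* K L"
  shows "\<exists>\<phi> \<psi>. strong_equivalence K L \<phi> \<psi>"
  using assms
proof (induction rule: rtranclp_induct)
  case base
  have "strong_equivalence K K id id"
    by (auto simp: strong_equivalence_def simplicial_map_def
        intro!: same_contiguity_class_id_if_fixes_vertices)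
  then show ?case by blast
next
  case (step L M)
  have "\<exists>\<phi> \<psi>. strong_equivalence L M \<phi> \<psi>"
    using step.hyps(2) strong_equivalence_of_collapse strong_equivalence_sym
    unfolding elementary_strong_move_def elementary_strong_collapse_def by metis
  then show ?case
    using step.IH strong_equivalence_trans by blast
qed

text \<open>The relabelled complexes at the ends of the chain of moves live over the natural numbers;
  relabellings are equivalences too and lead back to the given vertex types.\<close>

lemma strong_equivalence_of_same_strong_homotopy_type:
  assumes "same_strong_homotopy_type K L"
  shows "\<exists>\<phi> \<psi>. strong_equivalence K L \<phi> \<psi>"
proof -
  from assms obtain f g where "inj_on f (vertices K)" "inj_on g (vertices L)"
    and moves: "elementary_strong_move\<^sup>*\<^sup>* ((`) (f :: _ \<Rightarrow> nat) ` K) ((`) g ` L)"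
    unfolding same_strong_homotopy_type_def by blast
  then show ?thesis
    using strong_equivalence_relabelling[of f K] strong_equivalence_relabelling[of g L]
      strong_equivalence_of_moves[OF moves] strong_equivalence_sym strong_equivalence_trans
    by metis
qed

theorem theorem3p3:
  fixes K :: "'a set set" and L :: "'b set set"
  assumes "finite_simplicial_complex K" and "finite_simplicial_complex L"
    and "same_strong_homotopy_type K L"
  shows "discrete_TC K = discrete_TC L"
proof -
  have "simplicial_complex K" "simplicial_complex L"
    using assms by (simp_all add: finite_simplicial_complex_def)
  moreover obtain \<phi> \<psi> where "strong_equivalence K L \<phi> \<psi>"
    using strong_equivalence_of_same_strong_homotopy_type[OF assms(3)] by blast
  ultimately show ?thesis
    unfolding strong_equivalence_def
    by (meson antisym discrete_TC_le_if_dominated)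
qed

end
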